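(* Let $\mathbf{TM}_0\in\{0,1\}^{\mathbb N}$ denote the fixed point beginning in $0$ of the Thue-Morse morphism $0\mapsto 01$, $1\mapsto 10$, and let $\omega\in\{0,1\}^{\mathbb N}$ be a recurrent infinite word. Then $$\rho_{\omega}(n)=\rho_{\mathbf{TM}_0}(n)\ \text{ for all } n\in\mathbb N \quad\text{and}\quad \rho^{\mathrm{ab}}_{\omega}(n)=\rho^{\mathrm{ab}}_{\mathbf{TM}_0}(n)\ \text{ for all } n\in\mathbb N$$ if and only if $\omega$ is in the subshift generated by $\mathbf{TM}_0$.
   Context: A factor of an infinite word $\omega=\omega_0\omega_1\omega_2\cdots$ is a finite word of the form $\omega_i\omega_{i+1}\cdots\omega_{i+n-1}$. The subword complexity $\rho_\omega(n)$ is the number of distinct factors of $\omega$ of length $n$. Two finite words $u,v$ are Abelian equivalent if every letter occurs the same number of times in $u$ and in $v$; the Abelian complexity $\rho^{\mathrm{ab}}_\omega(n)$ is the number of Abelian equivalence classes of factors of $\omega$ of length $n$. An infinite word is recurrent if each of its factors occurs infinitely often in it. With $T$ the shift $(x_n)_{n}\mapsto(x_{n+1})_{n}$ on $\{0,1\}^{\mathbb N}$ (with the product topology), the subshift generated by a word $x$ is the closure of its orbit $\{T^m x: m\ge 0\}$. *)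

theory Defs
  imports "HOL-Analysis.Analysis" "HOL-Library.Omega_Words_Fun" "HOL-Library.Z2"
begin

text \<open>
  Infinite words are functions \<^typ>\<open>nat \<Rightarrow> 'a\<close> (the library's \<open>'a word\<close>), finite words are lists,
  and \<open>w [i \<rightarrow> j]\<close> is the finite word \<open>[w i, ..., w (j - 1)]\<close>. The alphabet
  \<open>{0,1}\<close> is the type \<^typ>\<open>bit\<close>, of which only the two elements matter here.
\<close>

definition factors :: "'a word \<Rightarrow> nat \<Rightarrow> 'a list set" where
  "factors w n = {w [i \<rightarrow> i + n] | i. True}"

definition subword_complexity :: "'a word \<Rightarrow> nat \<Rightarrow> nat" where
  "subword_complexity w n = card (factors w n)"

definition abelian_equivalent :: "'a list \<Rightarrow> 'a list \<Rightarrow> bool" where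
  "abelian_equivalent u v \<longleftrightarrow> (\<forall>a. count_list u a = count_list v a)"

definition abelian_complexity :: "'a word \<Rightarrow> nat \<Rightarrow> nat" where
  "abelian_complexity w n =
     card (factors w n // {(u, v) \<in> factors w n \<times> factors w n. abelian_equivalent u v})"

definition recurrent :: "'a word \<Rightarrow> bool" where
  "recurrent w \<longleftrightarrow> (\<forall>n. \<forall>u \<in> factors w n. infinite {i. w [i \<rightarrow> i + n] = u})"

definition shift :: "'a word \<Rightarrow> 'a word" where
  "shift x = (\<lambda>n. x (Suc n))"

definition subshift_generated_by :: "'a word \<Rightarrow> 'a word set" where
  "subshift_generated_by x =
     product_topology (\<lambda>_. discrete_topology UNIV) UNIV closure_of {(shift ^^ m) x | m. True}"

text \<open>
  The image of an infinite word under a morphism given by its values on letters. This is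
  the infinite concatenation \<open>f (x 0) @ f (x 1) @ ...\<close> provided that no \<open>f a\<close> is empty:
  then its \<open>n\<close>-th letter already occurs in the image of the first \<open>n + 1\<close> letters of \<open>x\<close>.
\<close>

definition morphism_image :: "('a \<Rightarrow> 'b list) \<Rightarrow> 'a word \<Rightarrow> 'b word" where
  "morphism_image f x = (\<lambda>n. concat (map f (x [0 \<rightarrow> Suc n])) ! n)"

definition thue_morse_morphism :: "bit \<Rightarrow> bit list" where
  "thue_morse_morphism a = (if a = 0 then [0, 1] else [1, 0])"

definition TM0 :: "bit word" where
  "TM0 = (THE x. x 0 = 0 \<and> morphism_image thue_morse_morphism x = x)"

text \<open>The description defining \<^const>\<open>TM0\<close> is proper.\<close>

lemma thue_morse_morphism_simps [simp]:
  "thue_morse_morphism 0 = [0, 1]" "thue_morse_morphism 1 = [1, 0]"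
  "length (thue_morse_morphism a) = 2"
  by (simp_all add: thue_morse_morphism_def)

lemma concat_thue_morse_morphism:
  fixes x :: "bit word"
  shows "length (concat (map thue_morse_morphism (x [0 \<rightarrow> m]))) = 2 * m"
    and "i < 2 * m \<Longrightarrow>
      concat (map thue_morse_morphism (x [0 \<rightarrow> m])) ! i = x (i div 2) + of_nat (i mod 2)"
proof (induction m)
  case 0
  { case 1 show ?case by simp }
  { case 2 then show ?case by simp }
next
  case (Suc m)
  have split: "x [0 \<rightarrow> Suc m] = x [0 \<rightarrow> m] @ [x m]"
    by (simp add: subsequence_def)
  { case 1 show ?case
      by (simp add: split Suc.IH(1)) }
  { case 2
    show ?case
    proof (cases "i < 2 * m")
      case True
      then show ?thesis by (simp add: split nth_append Suc.IH)
    next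
      case False
      with 2 have "i = 2 * m \<or> i = Suc (2 * m)" by auto
      then show ?thesis
        by (cases "x m") (auto simp add: split nth_append Suc.IH(1))
    qed }
qed

lemma morphism_image_thue_morse_morphism:
  "morphism_image thue_morse_morphism x n = x (n div 2) + of_nat (n mod 2)"
  unfolding morphism_image_def by (rule concat_thue_morse_morphism(2)) simp

fun thue_morse_rec :: "nat \<Rightarrow> bit" where
  "thue_morse_rec n = (if n = 0 then 0 else thue_morse_rec (n div 2) + of_nat (n mod 2))"

declare thue_morse_rec.simps [simp del]

lemma thue_morse_fixed_point_unique:
  "\<exists>!x. x 0 = 0 \<and> morphism_image thue_morse_morphism x = x"
proof
  show "thue_morse_rec 0 = 0 \<and> morphism_image thue_morse_morphism thue_morse_rec = thue_morse_rec"
  proof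
    show zero: "thue_morse_rec 0 = 0"
      by (simp add: thue_morse_rec.simps)
    show "morphism_image thue_morse_morphism thue_morse_rec = thue_morse_rec"
    proof
      fix n
      show "morphism_image thue_morse_morphism thue_morse_rec n = thue_morse_rec n"
        unfolding morphism_image_thue_morse_morphism
        by (cases "n = 0") (simp_all add: zero thue_morse_rec.simps [of n])
    qed
  qed
next
  fix x assume x: "x 0 = 0 \<and> morphism_image thue_morse_morphism x = x"
  have "x n = thue_morse_rec n" for n
  proof (induction n rule: less_induct)
    case (less n)
    show ?case
    proof (cases "n = 0")
      case True
      then show ?thesis using x by (simp add: thue_morse_rec.simps)
    next
      case False
      have "x n = x (n div 2) + of_nat (n mod 2)"
        using x morphism_image_thue_morse_morphism [of x n] by simp
      also have "\<dots> = thue_morse_rec n"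
        using False less [of "n div 2"] by (simp add: thue_morse_rec.simps [of n])
      finally show ?thesis .
    qed
  qed
  then show "x = thue_morse_rec" by blast
qed

lemma TM0_fixed_point: "TM0 0 = 0" "morphism_image thue_morse_morphism TM0 = TM0"
  using theI' [OF thue_morse_fixed_point_unique] unfolding TM0_def by blast+

end

theory Submission
  imports Defs
begin

text \<open>
The complexity of the Thue-Morse word nearly determines its subshift: among recurrent words with
this complexity it suffices to exclude those with three equal consecutive letters, and for this the
Abelian complexity at length 3 is enough.

So let \<open>v\<close> be a recurrent word with the complexity of the Thue-Morse word and without factors
\<open>000\<close> and \<open>111\<close>. The second difference of the complexity is a sum of contributions of bispecial
factors (\<open>second_difference\<close>), each of them -1, 0 or 1. In the cases needed there are at most two
bispecial factors and the second difference is 2 or -2, so that all contributions are known. At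
length 3 this says that the outer letters around \<open>010\<close> always differ or always agree, and similarly
for \<open>101\<close>. Agreement contradicts the second differences at lengths 6 and 8
(\<open>alternating_triple_extensions\<close>). If they differ, then successive occurrences of \<open>00\<close> and \<open>11\<close> are at
even distance (\<open>double_parity\<close>), so that \<open>v\<close>, up to a prefix, is the image of a word \<open>w\<close> under the
Thue-Morse morphism. The same assumptions hold for \<open>w\<close> (\<open>desubstitution\<close>), because the complexity of an
image is determined by that of its preimage and vice versa
(\<open>complexity_morphism_image\<close>). Repeating this, every factor of \<open>v\<close> is traced back to a factor of
length at most 2 of an iterated preimage, and hence is a factor of the Thue-Morse word
(\<open>thue_morse_like_window_factor_TM0\<close>). For a word, this property of its prefixes means that
it belongs to the subshift (\<open>in_subshift_iff\<close>).

Conversely, the Thue-Morse word is uniformly recurrent, so that every element of its subshift has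
exactly the same factors (\<open>factors_eq_if_in_subshift\<close>), and both complexities depend on the factors
alone.
\<close>

section \<open>Factors and recurrence\<close>

definition is_factor :: "'a word \<Rightarrow> 'a list \<Rightarrow> bool" where
  "is_factor v u \<longleftrightarrow> u \<in> factors v (length u)"

lemma is_factorI: "is_factor v (v [i \<rightarrow> j])"
  by (cases "i \<le> j") (auto simp: is_factor_def factors_def intro!: exI[of _ i])

lemma is_factorE:
  assumes "is_factor v u"
  obtains i where "u = v [i \<rightarrow> i + length u]"
  using assms by (auto simp: is_factor_def factors_def)

lemma factors_eq: "factors v n = {u. is_factor v u \<and> length u = n}"
  by (auto simp: is_factor_def factors_def)

lemma factors_conv_range: "factors v n = range (\<lambda>i. v [i \<rightarrow> i + n])"
  by (auto simp: factors_def)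

lemma subsequence_eq_iff:
  "v [i \<rightarrow> i + n] = w [j \<rightarrow> j + n] \<longleftrightarrow> (\<forall>k<n. v (i + k) = w (j + k))"
  by (auto simp: list_eq_iff_nth_eq)

lemma is_factor_appendD1:
  assumes "is_factor v (u @ z)"
  shows "is_factor v u"
proof -
  from assms obtain i where i: "u @ z = v [i \<rightarrow> i + length (u @ z)]" by (rule is_factorE)
  then have "u = take (length u) (v [i \<rightarrow> i + length (u @ z)])" by (metis append_eq_conv_conj)
  also have "\<dots> = v [i \<rightarrow> i + length u]" by (simp add: subsequence_def take_map)
  finally show ?thesis by (metis is_factorI)
qed

lemma is_factor_appendD2:
  assumes "is_factor v (u @ z)"
  shows "is_factor v z"
proof -
  from assms obtain i where i: "u @ z = v [i \<rightarrow> i + length (u @ z)]" by (rule is_factorE)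
  then have "z = drop (length u) (v [i \<rightarrow> i + length (u @ z)])" by (metis append_eq_conv_conj)
  also have "\<dots> = v [i + length u \<rightarrow> i + length (u @ z)]" by (simp add: subsequence_def drop_map)
  finally show ?thesis by (metis is_factorI)
qed

lemma is_factor_ConsD: "is_factor v (x # u) \<Longrightarrow> is_factor v u"
  using is_factor_appendD2[of v "[x]" u] by simp

lemma is_factor_right_extension:
  assumes "is_factor v u" shows "\<exists>y. is_factor v (u @ [y])"
proof -
  from assms obtain i where i: "u = v [i \<rightarrow> i + length u]" by (rule is_factorE)
  have "u @ [v (i + length u)] = v [i \<rightarrow> Suc (i + length u)]" 
    by (subst i) (simp add: subsequence_def)
  then show ?thesis by (metis is_factorI)
qed

lemma recurrent_later_occurrence:
  assumes "recurrent v"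
  obtains j where "m \<le> j" "\<And>k. k < n \<Longrightarrow> v (j + k) = v (i + k)"
proof -
  have "infinite {j. v [j \<rightarrow> j + n] = v [i \<rightarrow> i + n]}"
    using assms by (auto simp: recurrent_def factors_def)
  then obtain j where "j \<ge> m" "v [j \<rightarrow> j + n] = v [i \<rightarrow> i + n]"
    by (auto simp: infinite_nat_iff_unbounded_le)
  then show thesis by (intro that[of j]) (auto simp: subsequence_eq_iff)
qed

text \<open>
A prefix of a recurrent word can be extended to the left because it occurs again later.
\<close>

lemma is_factor_left_extension:
  assumes "recurrent v" "is_factor v u" shows "\<exists>x. is_factor v (x # u)"
proof -
  from assms(2) obtain i where i: "u = v [i \<rightarrow> i + length u]" by (rule is_factorE)
  obtain j where j: "1 \<le> j" "\<And>k. k < length u \<Longrightarrow> v (j + k) = v (i + k)"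
    using recurrent_later_occurrence[OF assms(1)] by metis
  have "u = v [j \<rightarrow> j + length u]" by (subst i) (simp add: subsequence_eq_iff j)
  then have "v (j - 1) # u = (v [j - 1 \<rightarrow> j + length u])"
    using j(1) by (simp add: subsequence_def upt_conv_Cons)
  then show ?thesis by (metis is_factorI)
qed

lemma is_factor_triple_iff:
  "is_factor v [a, b, c] \<longleftrightarrow> (\<exists>i. v i = a \<and> v (i + 1) = b \<and> v (i + 2) = c)"
proof -
  have "v [i \<rightarrow> i + 3] = [v i, v (i + 1), v (i + 2)]" for i
    by (simp add: subsequence_def numeral_eq_Suc upt_conv_Cons)
  then show ?thesis by (auto simp: is_factor_def factors_def numeral_3_eq_3[symmetric])
qed

lemma window_3: "is_factor v [v i, v (i + 1), v (i + 2)]"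
  unfolding is_factor_triple_iff by blast

lemma window_5: "is_factor v [v i, v (i + 1), v (i + 2), v (i + 3), v (i + 4)]"
  using is_factorI[of v i "i + 5"] by (simp add: subsequence_def numeral_eq_Suc upt_conv_Cons)

section \<open>The two-letter alphabet\<close>

lemma bit_all: "(\<forall>x::bit. P x) \<longleftrightarrow> P 0 \<and> P 1"
  by (metis bit.exhaust)

lemma UNIV_bit_eq: "(UNIV :: bit set) = {0, 1}"
  using bit.exhaust by blast

lemma finite_bit_set: "finite (A :: bit set)"
  by (rule finite_subset[of _ "UNIV"]) (auto simp: UNIV_bit_eq)

lemma card_bit_set: "card {x::bit. P x} = of_bool (P 0) + of_bool (P 1)"
proof -
  have "{x. P x} = (if P 0 then {0} else {}) \<union> (if P 1 then {1} else {})"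
  proof (rule set_eqI)
    fix x show "x \<in> {x. P x} \<longleftrightarrow> x \<in> (if P 0 then {0} else {}) \<union> (if P 1 then {1} else {})"
      by (cases x) auto
  qed
  then show ?thesis by (cases "P 0"; cases "P 1") simp_all
qed

lemma card_bit_pair_set:
  "card {(x::bit, y::bit). P x y} = of_bool (P 0 0) + of_bool (P 0 1) + of_bool (P 1 0) + of_bool (P 1 1)"
proof -
  have "{(x, y). P x y} = (SIGMA x:UNIV. {y. P x y})" by auto
  then have "card {(x, y). P x y} = (\<Sum>x\<in>UNIV. card {y. P x y})" 
    by (simp add: finite_bit_set)
  then show ?thesis by (simp add: UNIV_bit_eq card_bit_set)
qed

lemma bit_add_1_iff: "x \<noteq> y \<longleftrightarrow> y = x + 1" for x y :: bit
  by (cases x; cases y) auto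

lemma length_eq_3_iff: "length w = 3 \<longleftrightarrow> (\<exists>a b c. w = [a, b, c])"
  by (auto simp: numeral_eq_Suc length_Suc_conv)

section \<open>Bispecial factors and the second difference of the complexity\<close>

lemma finite_factors: "finite (factors (v :: bit word) n)"
  by (rule finite_subset[OF _ finite_lists_length_eq[of UNIV n]])
     (auto simp: factors_def UNIV_bit_eq)

definition left_degree :: "'a word \<Rightarrow> 'a list \<Rightarrow> nat" where
  "left_degree v w = card {x. is_factor v (x # w)}"

definition right_degree :: "'a word \<Rightarrow> 'a list \<Rightarrow> nat" where
  "right_degree v w = card {y. is_factor v (w @ [y])}"

definition bilateral_multiplicity :: "'a word \<Rightarrow> 'a list \<Rightarrow> int" where
  "bilateral_multiplicity v w =
     int (card {(x, y). is_factor v (x # w @ [y])}) - int (left_degree v w) - int (right_degree v w) + 1"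

lemma complexity_Suc_left:
  fixes v :: "bit word"
  shows "subword_complexity v (Suc n) = (\<Sum>w\<in>factors v n. left_degree v w)"
proof -
  have "factors v (Suc n) = (\<lambda>(w, x). x # w) ` (SIGMA w:factors v n. {x. is_factor v (x # w)})"
    by (force simp: factors_eq length_Suc_conv dest: is_factor_ConsD)
  then show ?thesis
    unfolding subword_complexity_def left_degree_def
    by (subst card_SigmaI [symmetric])
      (auto simp: card_image inj_on_def finite_factors finite_bit_set)
qed

lemma complexity_Suc_right:
  fixes v :: "bit word"
  shows "subword_complexity v (Suc n) = (\<Sum>w\<in>factors v n. right_degree v w)"
proof -
  have "factors v (Suc n) = (\<lambda>(w, y). w @ [y]) ` (SIGMA w:factors v n. {y. is_factor v (w @ [y])})"
    by (force simp: factors_eq length_Suc_conv_rev dest: is_factor_appendD1)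
  then show ?thesis
    unfolding subword_complexity_def right_degree_def
    by (subst card_SigmaI [symmetric])
      (auto simp: card_image inj_on_def finite_factors finite_bit_set)
qed

lemma complexity_Suc_Suc:
  fixes v :: "bit word"
  shows "subword_complexity v (Suc (Suc n)) = (\<Sum>w\<in>factors v n. card {(x, y). is_factor v (x # w @ [y])})"
proof -
  have fin: "finite {(x, y). is_factor v (x # w @ [y])}" for w
    by (rule finite_subset[of _ "UNIV::(bit \<times> bit) set"]) (auto simp: UNIV_bit_eq simp flip: UNIV_Times_UNIV)
  have sub: "factors v (Suc (Suc n)) \<subseteq> (\<lambda>(w, x, y). x # w @ [y]) ` (SIGMA w:factors v n. {(x, y). is_factor v (x # w @ [y])})"
  proof
    fix u assume u: "u \<in> factors v (Suc (Suc n))"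
    then obtain x u' where "u = x # u'" "length u' = Suc n" by (auto simp: factors_eq length_Suc_conv)
    moreover from this obtain w y where "u' = w @ [y]" "length w = n" by (auto simp: length_Suc_conv_rev)
    ultimately have "u = x # w @ [y]" "w \<in> factors v n" "is_factor v (x # w @ [y])"
      using u by (auto simp: factors_eq dest: is_factor_ConsD is_factor_appendD1)
    then show "u \<in> (\<lambda>(w, x, y). x # w @ [y]) ` (SIGMA w:factors v n. {(x, y). is_factor v (x # w @ [y])})"
      by force
  qed
  have "factors v (Suc (Suc n)) = (\<lambda>(w, x, y). x # w @ [y]) ` (SIGMA w:factors v n. {(x, y). is_factor v (x # w @ [y])})"
    using sub by (auto simp: factors_eq)
  then show ?thesis
    unfolding subword_complexity_def
    by (simp add: card_image inj_on_def finite_factors fin)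
qed

text \<open>
The number of factors of length \<open>n + 1\<close> is the sum of the numbers of one-letter extensions of the
factors of length \<open>n\<close>, on either side; the number of factors of length \<open>n + 2\<close> is the sum of the
numbers of two-sided extensions. Subtracting, the second difference of the complexity is a sum
of local contributions, the bilateral multiplicities.
\<close>

lemma second_difference:
  fixes v :: "bit word"
  shows "int (subword_complexity v (n + 2)) - 2 * int (subword_complexity v (n + 1)) + int (subword_complexity v n)
    = (\<Sum>w\<in>factors v n. bilateral_multiplicity v w)"
proof -
  have "(\<Sum>w\<in>factors v n. bilateral_multiplicity v w)
      = int (\<Sum>w\<in>factors v n. card {(x, y). is_factor v (x # w @ [y])})
        - int (\<Sum>w\<in>factors v n. left_degree v w) - int (\<Sum>w\<in>factors v n. right_degree v w)
        + int (card (factors v n))"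
    unfolding bilateral_multiplicity_def sum.distrib sum_subtractf of_nat_sum by simp
  then show ?thesis
    unfolding complexity_Suc_left[symmetric] complexity_Suc_right[symmetric]
      complexity_Suc_Suc[symmetric] subword_complexity_def[of v n, symmetric]
    by simp
qed

definition bispecial :: "'a word \<Rightarrow> 'a list \<Rightarrow> bool" where
  "bispecial v w \<longleftrightarrow> (\<forall>x. is_factor v (x # w)) \<and> (\<forall>y. is_factor v (w @ [y]))"

text \<open>
A factor is described by the \<open>2 \<times> 2\<close> Boolean matrix of its two-sided extensions. If it is not
bispecial, the matrix has a single nonzero row or column, and the contributions cancel. For a
bispecial factor the matrix has no zero row and no zero column, so it has between two and four
nonzero entries. Four entries (multiplicity 1) mean that all extensions occur; two entries
(multiplicity -1) mean that the matrix is a permutation matrix, which over the field with two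
elements is the graph of a translation.
\<close>

lemma
  fixes v :: "bit word"
  assumes "recurrent v" "is_factor v w"
  shows multiplicity_not_bispecial: "\<not> bispecial v w \<Longrightarrow> bilateral_multiplicity v w = 0"
    and multiplicity_upper: "bilateral_multiplicity v w \<le> 1"
    and multiplicity_lower: "bilateral_multiplicity v w \<ge> -1"
    and multiplicity_strong: "bilateral_multiplicity v w = 1 \<Longrightarrow> is_factor v (x # w @ [y])"
    and multiplicity_weak: "bilateral_multiplicity v w = - 1 \<Longrightarrow> \<exists>c. \<forall>x y. is_factor v (x # w @ [y]) \<longleftrightarrow> y = x + c"
proof -
  \<comment> \<open>The extension matrix; all degrees are expressed by its entries.\<close>
  define f where "f x y \<longleftrightarrow> is_factor v (x # w @ [y])" for x y
  have L: "is_factor v (x # w) \<longleftrightarrow> f x 0 \<or> f x 1" for x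
  proof
    assume "is_factor v (x # w)"
    then obtain y where "f x y" using is_factor_right_extension[of v "x # w"] by (auto simp: f_def)
    then show "f x 0 \<or> f x 1" by (cases y) auto
  next
    assume "f x 0 \<or> f x 1"
    then obtain y where "is_factor v ((x # w) @ [y])" by (auto simp: f_def)
    then show "is_factor v (x # w)" by (rule is_factor_appendD1)
  qed
  have R: "is_factor v (w @ [y]) \<longleftrightarrow> f 0 y \<or> f 1 y" for y
  proof
    assume "is_factor v (w @ [y])"
    then obtain x where "f x y" using is_factor_left_extension[OF assms(1), of "w @ [y]"] by (auto simp: f_def)
    then show "f 0 y \<or> f 1 y" by (cases x) auto
  next
    assume "f 0 y \<or> f 1 y"
    then obtain x where "is_factor v ([x] @ (w @ [y]))" by (auto simp: f_def)
    then show "is_factor v (w @ [y])" by (rule is_factor_appendD2)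
  qed
  obtain x' where "is_factor v (x' # w)" using is_factor_left_extension[OF assms] by auto
  then have W: "f 0 0 \<or> f 0 1 \<or> f 1 0 \<or> f 1 1" unfolding L by (cases x') auto
  have m: "bilateral_multiplicity v w = of_bool (f 0 0) + of_bool (f 0 1) + of_bool (f 1 0) + of_bool (f 1 1)
    - (of_bool (f 0 0 \<or> f 0 1) + of_bool (f 1 0 \<or> f 1 1)) - (of_bool (f 0 0 \<or> f 1 0) + of_bool (f 0 1 \<or> f 1 1)) + 1"
    unfolding bilateral_multiplicity_def left_degree_def right_degree_def L R card_bit_set
      f_def[symmetric] card_bit_pair_set by simp
  have b: "bispecial v w \<longleftrightarrow> (f 0 0 \<or> f 0 1) \<and> (f 1 0 \<or> f 1 1) \<and> (f 0 0 \<or> f 1 0) \<and> (f 0 1 \<or> f 1 1)"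
    unfolding bispecial_def L R bit_all by blast
  show "\<not> bispecial v w \<Longrightarrow> bilateral_multiplicity v w = 0"
    using W unfolding m b by (cases "f 0 0"; cases "f 0 1"; cases "f 1 0"; cases "f 1 1"; simp)
  show "bilateral_multiplicity v w \<le> 1" "bilateral_multiplicity v w \<ge> -1"
    using W unfolding m by (cases "f 0 0"; cases "f 0 1"; cases "f 1 0"; cases "f 1 1"; simp)+
  show "is_factor v (x # w @ [y])" if "bilateral_multiplicity v w = 1"
  proof -
    have "f 0 0 \<and> f 0 1 \<and> f 1 0 \<and> f 1 1"
      using that W unfolding m by (cases "f 0 0"; cases "f 0 1"; cases "f 1 0"; cases "f 1 1"; simp)
    then show ?thesis unfolding f_def[symmetric] by (cases x; cases y) auto
  qed
  show "\<exists>c. \<forall>x y. is_factor v (x # w @ [y]) \<longleftrightarrow> y = x + c" if "bilateral_multiplicity v w = -1"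
  proof -
    have "f 0 0 \<and> \<not> f 0 1 \<and> \<not> f 1 0 \<and> f 1 1 \<or> \<not> f 0 0 \<and> f 0 1 \<and> f 1 0 \<and> \<not> f 1 1"
      using that W unfolding m by (cases "f 0 0"; cases "f 0 1"; cases "f 1 0"; cases "f 1 1"; simp)
    then have "(\<forall>x y. f x y \<longleftrightarrow> y = x + 0) \<or> (\<forall>x y. f x y \<longleftrightarrow> y = x + 1)"
      unfolding bit_all by auto
    then show ?thesis unfolding f_def by blast
  qed
qed

text \<open>
With only two candidates for bispecial factors, a second difference of 2 or -2 is extremal,
so that both candidates occur and have extremal multiplicity.
\<close>

lemma multiplicities_of_bispecial_pair:
  fixes v :: "bit word"
  assumes "recurrent v"
    and "\<And>w. is_factor v w \<Longrightarrow> length w = n \<Longrightarrow> bispecial v w \<Longrightarrow> w \<in> {w1, w2}"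
    and "w1 \<noteq> w2" "length w1 = n" "length w2 = n"
    and e: "e \<in> {-1, 1}" "int (subword_complexity v (n + 2)) - 2 * int (subword_complexity v (n + 1)) + int (subword_complexity v n) = 2 * e"
  shows "is_factor v w1 \<and> bilateral_multiplicity v w1 = e \<and> is_factor v w2 \<and> bilateral_multiplicity v w2 = e"
proof -
  let ?m = "bilateral_multiplicity v"
  have "(\<Sum>w\<in>factors v n. ?m w) = (\<Sum>w\<in>factors v n \<inter> {w1, w2}. ?m w)"
    using assms(1,2) 
    by (intro sum.mono_neutral_right) (auto simp: finite_factors[unfolded factors_eq] factors_eq intro: multiplicity_not_bispecial)
  also have "\<dots> = (if is_factor v w1 then ?m w1 else 0) + (if is_factor v w2 then ?m w2 else 0)"
    using assms(3-5) by (auto simp: factors_eq Int_insert_right)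
  finally show ?thesis
    using second_difference[of v n] e multiplicity_upper[OF assms(1), of w1] multiplicity_upper[OF assms(1), of w2]
      multiplicity_lower[OF assms(1), of w1] multiplicity_lower[OF assms(1), of w2]
    by (auto split: if_splits)
qed

section \<open>Extensions of the alternating triples\<close>

text \<open>
If no letter occurs three times in a row, then a bispecial factor of length 3 must start and end
with a change of letter, hence is alternating. The second difference
\<open>12 - 2 * 10 + 6 = -2\<close> forces both alternating triples to have multiplicity -1. For each of them
one of two possibilities remains: the outer letters in an extension always differ (as in the
Thue-Morse word) or always agree.
\<close>

lemma alternating_triple_multiplicity:
  fixes v :: "bit word"
  assumes rec: "recurrent v" and cube: "\<And>a. \<not> is_factor v [a, a, a]"
    and "subword_complexity v 3 = 6" "subword_complexity v 4 = 10" "subword_complexity v 5 = 12"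
  shows "\<exists>d. \<forall>x y. is_factor v [x, a, a + 1, a, y] \<longleftrightarrow> y = x + d"
proof -
  have "is_factor v [0, 1, 0] \<and> bilateral_multiplicity v [0, 1, 0] = - 1 \<and> is_factor v [1, 0, 1] \<and> bilateral_multiplicity v [1, 0, 1] = - 1"
  proof (rule multiplicities_of_bispecial_pair[where n = 3, OF rec])
    fix w :: "bit list" assume "bispecial v w" "length w = 3"
    then obtain p q r where w: "w = [p, q, r]" "is_factor v [p, p, q, r]" "is_factor v [p, q, r, r]"
      by (auto simp: length_eq_3_iff bispecial_def)
    have "p \<noteq> q" "q \<noteq> r" 
      using cube[of p] cube[of r] is_factor_appendD1[of v "[p, p, q]" "[r]"] w(2) is_factor_ConsD[OF w(3)]
      by auto
    then show "w \<in> {[0, 1, 0], [1, 0, 1]}" using w(1) by (cases p; cases q; cases r) auto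
  qed (use assms(3-) in auto)
  then have "is_factor v [a, a + 1, a]" "bilateral_multiplicity v [a, a + 1, a] = -1" by (cases a; simp)+
  then show ?thesis using multiplicity_weak[OF rec, of "[a, a + 1, a]"] by auto
qed

text \<open>
The two-sided extensions of an alternating triple form a permutation matrix, so that the letter
before (after) it determines the one after (before) it. So a bispecial factor cannot begin with a
letter followed by an alternating continuation: after \<open>x, x + 1, x\<close> at its start, the fourth letter
would admit only one extension to the left. As it cannot start with a square of a letter either, only
\<open>x, x + 1, x + 1, x\<close> is left, and the same holds for its end.
\<close>

lemma bispecial_ends:
  fixes v :: "bit word"
  assumes cube: "\<And>a. \<not> is_factor v [a, a, a]"
    and d: "\<And>a x y. is_factor v [x, a, a + 1, a, y] \<longleftrightarrow> y = x + d a"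
    and w: "bispecial v w" "length w \<ge> 4"
  shows bispecial_prefix: "\<exists>x u. w = [x, x + 1, x + 1, x] @ u"
    and bispecial_suffix: "\<exists>x u. w = u @ [x, x + 1, x + 1, x]"
proof -
  obtain p q r s u where u: "w = [p, q, r, s] @ u"
    using w(2) by (auto simp: numeral_eq_Suc Suc_le_length_iff)
  have L: "is_factor v ([x, p, q, r, s] @ u)" for x using w(1) by (simp add: u bispecial_def)
  have L5: "is_factor v [x, p, q, r, s]" for x using L by (rule is_factor_appendD1)
  have L3: "is_factor v [x, p, q]" for x using L5 is_factor_appendD1[of v "[x, p, q]" "[r, s]"] by auto
  have L3': "is_factor v [q, r, s]" using L5 by (blast dest: is_factor_ConsD)
  have q: "q = p + 1" using cube[of p] L3[of p] bit_add_1_iff[of p q] by auto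
  have "r \<noteq> p"
  proof
    assume "r = p"
    then have "s = x + d p" for x using d[of x p s] L5[of x] q by simp
    from this[of 0] this[of 1] show False by (cases "d p") auto
  qed
  then have r: "r = p + 1" using bit_add_1_iff[of p r] by auto
  have "s = p" using cube[of q] L3' q r by (cases p; cases s) auto
  then show "\<exists>x u. w = [x, x + 1, x + 1, x] @ u" by (auto simp: u q r)
next
  define u where "u = take (length w - 4) w"
  define z where "z = drop (length w - 4) w"
  have "length z = 4" using w(2) by (simp add: z_def)
  then obtain p q r s where "z = [s, r, q, p]"
    by (auto simp: numeral_eq_Suc length_Suc_conv)
  then have u: "w = u @ [s, r, q, p]" using append_take_drop_id[of "length w - 4" w] by (simp add: u_def z_def)
  have L: "is_factor v (u @ [s, r, q, p, x])" for x using w(1) by (simp add: u bispecial_def)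
  have L5: "is_factor v [s, r, q, p, x]" for x using L by (rule is_factor_appendD2)
  have L3: "is_factor v [q, p, x]" for x using L5 by (blast dest: is_factor_ConsD)
  have L3': "is_factor v [s, r, q]" using L5[of 0] is_factor_appendD1[of v "[s, r, q]" "[p, 0]"] by auto
  have q: "q = p + 1" using cube[of p] L3[of p] bit_add_1_iff[of p q] by auto
  have "r \<noteq> p"
  proof
    assume "r = p"
    then have "x = s + d p" for x using d[of s p x] L5[of x] q by simp
    from this[of 0] this[of 1] show False by (cases "s + d p") auto
  qed
  then have r: "r = p + 1" using bit_add_1_iff[of p r] by auto
  have "s = p" using cube[of q] L3' q r by (cases p; cases s) auto
  then show "\<exists>x u. w = u @ [x, x + 1, x + 1, x]" by (auto simp: u q r)
qed

lemma bispecial_length_6: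
  fixes v :: "bit word"
  assumes "\<And>a. \<not> is_factor v [a, a, a]"
    and "\<And>a x y. is_factor v [x, a, a + 1, a, y] \<longleftrightarrow> y = x + d a"
    and "bispecial v w" "length w = 6"
  shows "w \<in> {[0, 1, 1, 0, 0, 1], [1, 0, 0, 1, 1, 0]}"
proof -
  obtain x u where "w = [x, x + 1, x + 1, x] @ u"
    using bispecial_prefix[OF assms(1-3)] assms(4) by auto
  moreover obtain y u' where "w = u' @ [y, y + 1, y + 1, y]"
    using bispecial_suffix[OF assms(1-3)] assms(4) by auto
  moreover from this assms(4) obtain r s where "u' = [r, s]"
    by (auto simp: numeral_eq_Suc length_Suc_conv)
  ultimately show ?thesis by (cases x; cases y) auto
qed

text \<open>
By the shape of prefix and suffix, \<open>w\<close> consists of two blocks \<open>x, x + 1, x + 1, x\<close>. Two different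
blocks would contain extensions of both alternating triples whose outer letters differ.
\<close>

lemma bispecial_length_8:
  fixes v :: "bit word"
  assumes "\<And>a. \<not> is_factor v [a, a, a]"
    and d: "\<And>a x y. is_factor v [x, a, a + 1, a, y] \<longleftrightarrow> y = x + d a"
    and "d b = 0" and w: "bispecial v w" "length w = 8"
  shows "w \<in> {[0, 1, 1, 0, 0, 1, 1, 0], [1, 0, 0, 1, 1, 0, 0, 1]}"
proof -
  obtain x u where x: "w = [x, x + 1, x + 1, x] @ u"
    using bispecial_prefix[OF assms(1,2) w(1)] w(2) by auto
  obtain y u' where y: "w = u' @ [y, y + 1, y + 1, y]"
    using bispecial_suffix[OF assms(1,2) w(1)] w(2) by auto
  have "length u' = 4" using y w(2) by simp
  then have "drop 4 w = [y, y + 1, y + 1, y]" unfolding y by simp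
  then have u: "u = [y, y + 1, y + 1, y]" unfolding x by simp
  have "y = x"
  proof (rule ccontr)
    assume "y \<noteq> x"
    then have y1: "y = x + 1" using bit_add_1_iff by blast
    have "is_factor v w" using w(1) by (auto simp: bispecial_def dest: is_factor_ConsD)
    then have f: "is_factor v [x, x + 1, x + 1, x, x + 1, x, x, x + 1]" by (cases x) (simp_all add: x u y1)
    have "is_factor v ([x + 1, x + 1, x, x + 1, x] @ [x, x + 1])" using is_factor_ConsD[OF f] by simp
    moreover have "is_factor v ([x + 1, x, x + 1, x, x] @ [x + 1])"
      using is_factor_ConsD[OF is_factor_ConsD[OF f]] by simp
    ultimately have "is_factor v [x + 1, x + 1, x, x + 1, x]" "is_factor v [x + 1, x, x + 1, x, x]"
      by (blast dest: is_factor_appendD1)+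
    then have "is_factor v [x + 1, x + 1, (x + 1) + 1, x + 1, x]" "is_factor v [x + 1, x, x + 1, x, x]"
      by (cases x; simp)+
    then have "x = x + 1 + d (x + 1)" "x = x + 1 + d x" unfolding d by auto
    then show False using \<open>d b = 0\<close> by (cases x; cases b) auto
  qed
  then show ?thesis by (cases x) (auto simp: x u)
qed

text \<open>
The complexity up to length 10 excludes that the outer letters agree in the extensions of an
alternating triple. In that case the only possible bispecial factors of length 6 are
\<open>011001\<close> and \<open>100110\<close>, those of length 8 are \<open>01100110\<close> and \<open>10011001\<close>. The second differences
\<open>22 - 2 * 20 + 16 = -2\<close> and \<open>28 - 2 * 24 + 22 = 2\<close> show that \<open>011001\<close> has multiplicity -1 and
\<open>01100110\<close> has multiplicity 1. The latter can be extended by both letters on the left, and then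
\<open>011001\<close>, followed by \<open>1\<close>, is preceded by both letters, which its multiplicity forbids.
\<close>

lemma alternating_triple_extensions:
  fixes v :: "bit word"
  assumes rec: "recurrent v" and cube: "\<And>a. \<not> is_factor v [a, a, a]"
    and c: "subword_complexity v 3 = 6" "subword_complexity v 4 = 10" "subword_complexity v 5 = 12"
      "subword_complexity v 6 = 16" "subword_complexity v 7 = 20" "subword_complexity v 8 = 22"
      "subword_complexity v 9 = 24" "subword_complexity v 10 = 28"
  shows "is_factor v [x, a, a + 1, a, y] \<longleftrightarrow> y = x + 1"
proof -
  have "\<forall>a. \<exists>d. \<forall>x y. is_factor v [x, a, a + 1, a, y] \<longleftrightarrow> y = x + d"
    using alternating_triple_multiplicity[OF rec cube c(1-3)] by auto
  then obtain d where d: "\<And>a x y. is_factor v [x, a, a + 1, a, y] \<longleftrightarrow> y = x + d a"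
    by metis
  have "d a \<noteq> 0" for a
  proof
    assume 0: "d a = 0"
    have "is_factor v [0, 1, 1, 0, 0, 1] \<and> bilateral_multiplicity v [0, 1, 1, 0, 0, 1] = - 1 \<and>
       is_factor v [1, 0, 0, 1, 1, 0] \<and> bilateral_multiplicity v [1, 0, 0, 1, 1, 0] = - 1"
      by (rule multiplicities_of_bispecial_pair[OF rec, of 6])
        (use bispecial_length_6[OF cube d] c in auto)
    then obtain e where e: "\<And>x y. is_factor v (x # [0, 1, 1, 0, 0, 1] @ [y]) \<longleftrightarrow> y = x + e"
      using multiplicity_weak[OF rec, of "[0, 1, 1, 0, 0, 1]"] by blast
    have "is_factor v [0, 1, 1, 0, 0, 1, 1, 0] \<and> bilateral_multiplicity v [0, 1, 1, 0, 0, 1, 1, 0] = 1 \<and>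
       is_factor v [1, 0, 0, 1, 1, 0, 0, 1] \<and> bilateral_multiplicity v [1, 0, 0, 1, 1, 0, 0, 1] = 1"
      by (rule multiplicities_of_bispecial_pair[OF rec, of 8])
        (use bispecial_length_8[OF cube d 0] c in auto)
    then have "is_factor v (x # [0, 1, 1, 0, 0, 1, 1, 0] @ [0])" for x
      using multiplicity_strong[OF rec] by blast
    then have "is_factor v (x # [0, 1, 1, 0, 0, 1] @ [1])" for x
      using is_factor_appendD1[of v "x # [0, 1, 1, 0, 0, 1] @ [1]" "[0, 0]"] by simp
    then have "1 = x + e" for x unfolding e .
    from this[of 0] this[of 1] show False by (cases e) auto
  qed
  then have "d a = 1" by simp
  then show ?thesis using d[of x a y] by (simp only:)
qed

text \<open>
After a square of a letter at position \<open>i\<close>, the next one starts at \<open>i + 2\<close> or at \<open>i + 4\<close>: the letters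
continue as \<open>x, x, x + 1\<close>, and if no square starts at \<open>i + 2\<close>, then the outer letters of the
alternating triples force \<open>x, x, x + 1, x, x + 1, x + 1\<close>. So no square starts at an odd distance.
\<close>

lemma double_parity:
  fixes v :: "bit word"
  assumes cube: "\<And>a. \<not> is_factor v [a, a, a]"
    and d: "\<And>a x y. is_factor v [x, a, a + 1, a, y] \<longleftrightarrow> y = x + 1"
  assumes "v i = v (i + 1)"
  shows "v (i + 2 * k + 1) \<noteq> v (i + 2 * k + 2)"
  using assms(3)
proof (induction k arbitrary: i rule: less_induct)
  case (less k)
  define x where "x = v i"
  have x: "v i = x" "v (i + 1) = x" using less.prems by (simp_all add: x_def)
  have 2: "v (i + 2) = x + 1"
  proof -
    have "is_factor v [x, x, v (i + 2)]" using window_3[of v i] unfolding x .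
    then show ?thesis using cube[of x] bit_add_1_iff[of x "v (i + 2)"] by auto
  qed
  show ?case
  proof (cases "k = 0")
    case True
    then show ?thesis using x 2 by (simp add: numeral_2_eq_2)
  next
    case k: False
    show ?thesis
    proof (cases "v (i + 3) = x + 1")
      case True
      then have "v (i + 2) = v (i + 2 + 1)" using 2 by (simp add: numeral_eq_Suc)
      from less.IH[OF _ this, of "k - 1"] k show ?thesis
        by (cases k) auto
    next
      case False
      then have 3: "v (i + 3) = x" using bit_add_1_iff[of "v (i + 3)" "x + 1"] by (cases x) auto
      have 4: "v (i + 4) = x + 1" 
      proof -
        have "is_factor v [x, x, x + 1, x, v (i + 4)]" using window_5[of v i] unfolding x 2 3 .
        then show ?thesis unfolding d .
      qed
      have "is_factor v [x, x + 1, (x + 1) + 1, x + 1, v (i + 5)]"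
      proof -
        have i: "i + 1 + 1 = i + 2" "i + 1 + 2 = i + 3" "i + 1 + 3 = i + 4" "i + 1 + 4 = i + 5"
          by simp_all
        have "is_factor v [x, x + 1, x, x + 1, v (i + 5)]"
          using window_5[of v "i + 1"] unfolding i x 2 3 4 .
        then show ?thesis by (cases x) simp_all
      qed
      then have 5: "v (i + 5) = x + 1" unfolding d .
      show ?thesis
      proof (cases "k = 1")
        case True
        then show ?thesis using 3 4 by (simp add: numeral_eq_Suc)
      next
        case False
        have "v (i + 4) = v (i + 4 + 1)" using 4 5 by (simp add: numeral_eq_Suc)
        from less.IH[OF _ this, of "k - 2"] k False
        have "v (i + 4 + 2 * (k - 2) + 1) \<noteq> v (i + 4 + 2 * (k - 2) + 2)" by simp
        moreover have "i + 4 + 2 * (k - 2) = i + 2 * k" using k False by simp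
        ultimately show ?thesis by simp
      qed
    qed
  qed
qed

section \<open>Images under the Thue-Morse morphism\<close>

lemma recurrentI:
  assumes "\<And>i n m. \<exists>j\<ge>m. \<forall>k<n. v (j + k) = v (i + k)"
  shows "recurrent v"
  unfolding recurrent_def factors_def infinite_nat_iff_unbounded_le
proof clarify
  fix n m i
  show "\<exists>j\<ge>m. j \<in> {j. v [j \<rightarrow> j + n] = v [i \<rightarrow> i + n]}"
    using assms[of m n i] by (auto simp: subsequence_eq_iff)
qed

lemma suffix_eq_morphism_image_iff:
  "suffix p v = morphism_image thue_morse_morphism w \<longleftrightarrow>
    (\<forall>k. v (p + k) = w (k div 2) + of_nat (k mod 2))"
  by (auto simp: fun_eq_iff suffix_def morphism_image_thue_morse_morphism)

lemma TM0_rec: "TM0 k = TM0 (k div 2) + of_nat (k mod 2)"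
  by (metis TM0_fixed_point(2) morphism_image_thue_morse_morphism)

lemma TM0_double: "TM0 (2 * n) = TM0 n" "TM0 (2 * n + 1) = TM0 n + 1"
  using TM0_rec[of "2 * n"] TM0_rec[of "2 * n + 1"] by simp_all

lemma suffix_0_TM0: "suffix 0 TM0 = morphism_image thue_morse_morphism TM0"
  by (simp add: TM0_fixed_point(2) suffix_def)

lemma card_range_cong:
  assumes "\<And>i j. f i = f j \<longleftrightarrow> g i = g j"
  shows "card (range f) = card (range g)"
proof -
  have "bij_betw (\<lambda>y. g (inv f y)) (range f) (range g)"
  proof (rule bij_betwI')
    fix x y assume "x \<in> range f" "y \<in> range f"
    then show "g (inv f x) = g (inv f y) \<longleftrightarrow> x = y"
      by (metis assms f_inv_into_f)
  next
    fix y assume "y \<in> range g"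
    then obtain i where "y = g i" by auto
    then have "y = g (inv f (f i))" using assms by (metis f_inv_into_f rangeI)
    then show "\<exists>x\<in>range f. y = g (inv f x)" by blast
  qed auto
  then show ?thesis by (rule bij_betw_same_card)
qed

text \<open>
A factor of length \<open>N\<close> of the image starts either at the boundary of two blocks or inside a block;
in the two cases it is determined by, and determines, the factor of \<open>w\<close> formed by the blocks that
it meets. Both cases cannot hold for the same factor of length at least 4, since it would be
alternating and come from three equal letters of \<open>w\<close>.
\<close>

lemma complexity_morphism_image:
  fixes v w :: "bit word"
  assumes vw: "suffix p v = morphism_image thue_morse_morphism w"
    and rec: "p = 0 \<or> recurrent v"
    and cube: "\<And>a. \<not> is_factor w [a, a, a]"
    and N: "N \<ge> 4"
  shows "subword_complexity v N
    = subword_complexity w ((N + 1) div 2) + subword_complexity w (N div 2 + 1)"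
proof -
  have v: "v (p + k) = w (k div 2) + of_nat (k mod 2)" for k
    using vw by (simp add: suffix_eq_morphism_image_iff)
  define f where "f i = v [p + i \<rightarrow> p + i + N]" for i
  have f_eq: "f i = f j \<longleftrightarrow> (\<forall>k<N. v (p + (i + k)) = v (p + (j + k)))" for i j
    using subsequence_eq_iff[of v "p + i" N v "p + j"] by (simp add: f_def add.assoc)
  have "factors v N = range f"
  proof
    show "range f \<subseteq> factors v N" by (auto simp: factors_def f_def)
    show "factors v N \<subseteq> range f"
    proof
      fix u assume "u \<in> factors v N"
      then obtain i where i: "u = v [i \<rightarrow> i + N]" by (auto simp: factors_def)
      obtain j where j: "p \<le> j" "\<forall>k<N. v (j + k) = v (i + k)"
        using rec recurrent_later_occurrence[of v p N i] by (metis zero_le)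
      then have "u = f (j - p)" by (simp add: i f_def subsequence_eq_iff)
      then show "u \<in> range f" by blast
    qed
  qed
  moreover have "range f = range (\<lambda>i. f (2 * i)) \<union> range (\<lambda>i. f (2 * i + 1))"
  proof -
    have "f i \<in> range (\<lambda>i. f (2 * i)) \<union> range (\<lambda>i. f (2 * i + 1))" for i
      by (cases "even i") (auto elim!: evenE oddE)
    then show ?thesis by auto
  qed
  moreover have "range (\<lambda>i. f (2 * i)) \<inter> range (\<lambda>i. f (2 * i + 1)) = {}"
  proof -
    have False if "f (2 * i) = f (2 * j + 1)" for i j
    proof -
      have e: "v (p + (2 * i + k)) = v (p + (2 * j + 1 + k))" if "k < 4" for k
        using \<open>f (2 * i) = f (2 * j + 1)\<close> that N by (simp add: f_eq)
      have even: "v (p + 2 * m) = w m" and odd: "v (p + (2 * m + 1)) = w m + 1" for m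
        unfolding v by simp_all
      have "w i = w j + 1" using e[of 0] even[of i] odd[of j] by simp
      moreover have "w i + 1 = w (j + 1)" using e[of 1] odd[of i] even[of "j + 1"] by simp
      moreover have "w (i + 1) = w (j + 1) + 1" using e[of 2] even[of "i + 1"] odd[of "j + 1"] by simp
      moreover have "w (i + 1) + 1 = w (j + 2)"
        using e[of 3] odd[of "i + 1"] even[of "j + 2"] by (simp add: numeral_eq_Suc)
      ultimately have "w (j + 1) = w j" "w (j + 2) = w j" by (cases "w j"; simp)+
      then show False using window_3[of w j] cube[of "w j"] by simp
    qed
    then show ?thesis by auto
  qed
  moreover have "card (range (\<lambda>i. f (2 * i))) = subword_complexity w ((N + 1) div 2)"
    unfolding subword_complexity_def factors_conv_range
  proof (rule card_range_cong)
    fix i j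
    have div: "(2 * i + k) div 2 = i + k div 2" "(2 * i + k) mod 2 = k mod 2" for i k :: nat
      by simp_all
    have "f (2 * i) = f (2 * j) \<longleftrightarrow> (\<forall>k<N. w (i + k div 2) = w (j + k div 2))"
      unfolding f_eq v div add_right_cancel ..
    also have "\<dots> \<longleftrightarrow> (\<forall>l<(N + 1) div 2. w (i + l) = w (j + l))"
    proof (intro iffI allI impI)
      fix l assume *: "\<forall>k<N. w (i + k div 2) = w (j + k div 2)" "l < (N + 1) div 2"
      then show "w (i + l) = w (j + l)" using *(1)[rule_format, of "2 * l"] by simp
    next
      fix k assume *: "\<forall>l<(N + 1) div 2. w (i + l) = w (j + l)" "k < N"
      then have "k div 2 < (N + 1) div 2" by linarith
      then show "w (i + k div 2) = w (j + k div 2)" using * by blast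
    qed
    finally show "f (2 * i) = f (2 * j) \<longleftrightarrow> w [i \<rightarrow> i + (N + 1) div 2] = w [j \<rightarrow> j + (N + 1) div 2]"
      by (simp only: subsequence_eq_iff)
  qed
  moreover have "card (range (\<lambda>i. f (2 * i + 1))) = subword_complexity w (N div 2 + 1)"
    unfolding subword_complexity_def factors_conv_range
  proof (rule card_range_cong)
    fix i j
    have div: "(2 * i + 1 + k) div 2 = i + (k + 1) div 2" "(2 * i + 1 + k) mod 2 = (k + 1) mod 2" for i k :: nat
      by presburger+
    have "f (2 * i + 1) = f (2 * j + 1) \<longleftrightarrow> (\<forall>k<N. w (i + (k + 1) div 2) = w (j + (k + 1) div 2))"
      unfolding f_eq v div add_right_cancel ..
    also have "\<dots> \<longleftrightarrow> (\<forall>l<N div 2 + 1. w (i + l) = w (j + l))"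
    proof (intro iffI allI impI)
      fix l assume *: "\<forall>k<N. w (i + (k + 1) div 2) = w (j + (k + 1) div 2)" "l < N div 2 + 1"
      have "2 * l - 1 < N" "(2 * l - 1 + 1) div 2 = l" using *(2) N by auto
      then show "w (i + l) = w (j + l)" using *(1) by metis
    next
      fix k assume *: "\<forall>l<N div 2 + 1. w (i + l) = w (j + l)" "k < N"
      then have "(k + 1) div 2 < N div 2 + 1" by linarith
      then show "w (i + (k + 1) div 2) = w (j + (k + 1) div 2)" using * by blast
    qed
    finally show "f (2 * i + 1) = f (2 * j + 1) \<longleftrightarrow> w [i \<rightarrow> i + (N div 2 + 1)] = w [j \<rightarrow> j + (N div 2 + 1)]"
      by (simp only: subsequence_eq_iff)
  qed
  moreover have "finite (range f)" using finite_factors[of v N] \<open>factors v N = range f\<close> by simp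
  ultimately show ?thesis 
    unfolding subword_complexity_def[of v] by (simp add: card_Un_disjoint)
qed

section \<open>Short factors and complexity of the Thue-Morse word\<close>

lemma TM0_no_cube: "\<not> is_factor TM0 [a, a, a]"
proof
  assume "is_factor TM0 [a, a, a]"
  then obtain i where e: "TM0 i = a" "TM0 (i + 1) = a" "TM0 (i + 2) = a"
    unfolding is_factor_triple_iff by blast
  show False
  proof (cases "even i")
    case True
    then obtain n where "i = 2 * n" by blast
    then show False using e(1,2) TM0_double[of n] by (cases a) simp_all
  next
    case False
    then obtain n where "i = 2 * n + 1" by (blast elim: oddE)
    then show False using e(2,3) TM0_double[of "n + 1"] by (cases a) simp_all
  qed
qed

definition cube_free_triples :: "bit list set" where
  "cube_free_triples = {[0, 0, 1], [0, 1, 0], [0, 1, 1], [1, 0, 0], [1, 0, 1], [1, 1, 0]}"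

lemma factors_3_subset:
  fixes v :: "bit word"
  assumes "\<And>a. \<not> is_factor v [a, a, a]"
  shows "factors v 3 \<subseteq> cube_free_triples"
proof
  fix u assume "u \<in> factors v 3"
  then obtain p q r where "u = [p, q, r]" "is_factor v [p, q, r]"
    by (auto simp: factors_eq length_eq_3_iff)
  then show "u \<in> cube_free_triples"
    using assms by (cases p; cases q; cases r) (auto simp: cube_free_triples_def)
qed

lemma TM0_values: "TM0 1 = 1" "TM0 2 = 1" "TM0 3 = 0" "TM0 4 = 1" "TM0 5 = 0" "TM0 6 = 0" "TM0 7 = 1"
proof -
  show 1: "TM0 1 = 1" using TM0_double(2)[of 0] TM0_fixed_point(1) by simp
  show 2: "TM0 2 = 1" using TM0_double(1)[of 1] 1 by simp
  show 3: "TM0 3 = 0" using TM0_double(2)[of 1] 1 by simp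
  show "TM0 4 = 1" using TM0_double(1)[of 2] 2 by simp
  show "TM0 5 = 0" using TM0_double(2)[of 2] 2 by simp
  show "TM0 6 = 0" using TM0_double(1)[of 3] 3 by simp
  show "TM0 7 = 1" using TM0_double(2)[of 3] 3 by simp
qed

lemma factors_TM0_3: "factors TM0 3 = cube_free_triples"
proof
  show "cube_free_triples \<subseteq> factors TM0 3"
    using window_3[of TM0 0] window_3[of TM0 1] window_3[of TM0 2] window_3[of TM0 3]
      window_3[of TM0 4] window_3[of TM0 5]
      TM0_fixed_point(1) TM0_values
    by (simp add: cube_free_triples_def factors_eq numeral_eq_Suc)
qed (rule factors_3_subset[OF TM0_no_cube])

lemma pair_is_factor_TM0: "is_factor TM0 [x, y]"
proof -
  have "\<exists>z. [x, y, z] \<in> factors TM0 3"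
    unfolding factors_TM0_3 cube_free_triples_def by (cases x; cases y) auto
  then show ?thesis using is_factor_appendD1[of TM0 "[x, y]"] by (auto simp: factors_eq)
qed

text \<open>
The Thue-Morse word is its own image, so its complexity satisfies the recurrence for images.
\<close>

lemma complexity_TM0:
  "subword_complexity TM0 3 = 6" "subword_complexity TM0 4 = 10" "subword_complexity TM0 5 = 12"
  "subword_complexity TM0 6 = 16" "subword_complexity TM0 7 = 20" "subword_complexity TM0 8 = 22"
  "subword_complexity TM0 9 = 24" "subword_complexity TM0 10 = 28"
proof -
  have rule: "subword_complexity TM0 N
      = subword_complexity TM0 ((N + 1) div 2) + subword_complexity TM0 (N div 2 + 1)" if "N \<ge> 4" for N
    by (rule complexity_morphism_image[OF suffix_0_TM0 _ TM0_no_cube that]) simp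
  have "factors TM0 2 = {[0, 0], [0, 1], [1, 0], [1, 1]}"
  proof -
    have "factors TM0 2 = {u. length u = 2}"
      by (auto simp: factors_eq numeral_eq_Suc length_Suc_conv pair_is_factor_TM0)
    also have "\<dots> = (\<Union>x\<in>UNIV. \<Union>y\<in>UNIV. {[x, y]})" by (auto simp: numeral_eq_Suc length_Suc_conv)
    finally show ?thesis unfolding UNIV_bit_eq by auto
  qed
  then have 2: "subword_complexity TM0 2 = 4" by (simp add: subword_complexity_def)
  show 3: "subword_complexity TM0 3 = 6"
    by (simp add: subword_complexity_def factors_TM0_3 cube_free_triples_def)
  show 4: "subword_complexity TM0 4 = 10" using rule[of 4] 2 3 by simp
  show 5: "subword_complexity TM0 5 = 12" using rule[of 5] 3 by simp
  show 6: "subword_complexity TM0 6 = 16" using rule[of 6] 3 4 by simp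
  show "subword_complexity TM0 7 = 20" using rule[of 7] 4 by simp
  show "subword_complexity TM0 8 = 22" using rule[of 8] 4 5 by simp
  show "subword_complexity TM0 9 = 24" using rule[of 9] 5 by simp
  show "subword_complexity TM0 10 = 28" using rule[of 10] 5 6 by simp
qed

section \<open>Desubstitution\<close>

text \<open>
The complexity is prescribed only from length 3 on because the recurrence for images determines
the complexity of a preimage only in that range.
\<close>

definition thue_morse_like :: "bit word \<Rightarrow> bool" where
  "thue_morse_like v \<longleftrightarrow> recurrent v \<and> (\<forall>a. \<not> is_factor v [a, a, a]) \<and>
     (\<forall>n\<ge>3. subword_complexity v n = subword_complexity TM0 n)"

text \<open>
All squares of letters start at positions of the same parity. Cutting the word into blocks of
length 2 just behind the first letter of such a square therefore gives only the blocks
\<open>01\<close> and \<open>10\<close>, which are images of letters. The preimage inherits all properties: a long factor of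
the word contains a square of a letter and so occurs only at positions of one parity, which yields
recurrence; three equal letters in the preimage would produce six letters without a square of a
letter, while every five letters contain one; and at odd lengths \<open>2 * n - 1\<close> the complexity
of the image is twice the complexity of the preimage at length \<open>n\<close>.
\<close>

lemma desubstitution:
  assumes "thue_morse_like v"
  obtains p w where "thue_morse_like w" "suffix p v = morphism_image thue_morse_morphism w"
proof -
  have rec: "recurrent v" and cube: "\<And>a. \<not> is_factor v [a, a, a]"
    and c: "\<And>n. n \<ge> 3 \<Longrightarrow> subword_complexity v n = subword_complexity TM0 n"
    using assms by (auto simp: thue_morse_like_def)
  have d: "is_factor v [x, a, a + 1, a, y] \<longleftrightarrow> y = x + 1" for x a y
    by (rule alternating_triple_extensions[OF rec cube]) (simp_all add: c complexity_TM0)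
  note parity = double_parity[OF cube d]
  have even_sum: "even (i + j)" if "v i = v (i + 1)" "v j = v (j + 1)" for i j
  proof -
    have *: "even (i + j)" if "i \<le> j" "v i = v (i + 1)" "v j = v (j + 1)" for i j
    proof (rule ccontr)
      assume "odd (i + j)"
      then have "odd (j - i)" using \<open>i \<le> j\<close> by simp
      then obtain k where "j - i = 2 * k + 1" by (blast elim: oddE)
      then have "j = i + 2 * k + 1" using \<open>i \<le> j\<close> by simp
      then show False using parity[OF that(2), of k] that(3) by simp
    qed
    show ?thesis
    proof (cases "i \<le> j")
      case True
      then show ?thesis using that by (rule *)
    next
      case False
      then have "even (j + i)" using that by (intro *[of j i]) simp_all
      then show ?thesis by (simp only: add.commute)
    qed
  qed
  have window: "\<exists>s<4. v (i + s) = v (i + s + 1)" for i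
  proof (rule ccontr)
    assume "\<not> ?thesis"
    then have "v (i + s + 1) = v (i + s) + 1" if "s < 4" for s 
      using that bit_add_1_iff by blast
    from this[of 0] this[of 1] this[of 2] this[of 3]
    have *: "v (i + 1) = v i + 1" "v (i + 2) = (v i + 1) + 1" "v (i + 3) = v i + 1" "v (i + 4) = v i"
      by (cases "v i"; simp add: numeral_eq_Suc)+
    have "is_factor v [v i, v i + 1, (v i + 1) + 1, v i + 1, v i]"
      using window_5[of v i] unfolding * .
    then have "v i = v i + 1" unfolding d .
    then show False by (cases "v i") auto
  qed
  obtain i0 where i0: "v i0 = v (i0 + 1)" using window[of 0] by auto
  \<comment> \<open>A block boundary in the middle of a square.\<close>
  define p where "p = i0 + 1"
  define w where "w k = v (p + 2 * k)" for k
  have odd: "v (p + 2 * k + 1) = v (p + 2 * k) + 1" for k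
  proof -
    have "v (p + 2 * k) \<noteq> v (p + 2 * k + 1)"
    proof
      assume "v (p + 2 * k) = v (p + 2 * k + 1)"
      with i0 have "even (i0 + (p + 2 * k))" by (rule even_sum)
      then show False by (simp add: p_def)
    qed
    then show ?thesis unfolding bit_add_1_iff .
  qed
  have v: "v (p + k) = w (k div 2) + of_nat (k mod 2)" for k
  proof (cases "even k")
    case True
    then show ?thesis by (auto simp: w_def elim!: evenE)
  next
    case False
    then obtain l where "k = 2 * l + 1" by (blast elim: oddE)
    then show ?thesis using odd[of l] by (simp add: w_def)
  qed
  then have vw: "suffix p v = morphism_image thue_morse_morphism w"
    by (simp add: suffix_eq_morphism_image_iff)
  have "recurrent w"
  proof (rule recurrentI)
    fix i n m
    \<comment> \<open>A window that contains a square, so that its later occurrences have the same parity.\<close>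
    obtain s where s: "s < 4" "v (p + 2 * i + s) = v (p + 2 * i + s + 1)" using window by blast
    obtain j where j: "p + 2 * m \<le> j" "\<And>k. k < 2 * n + 5 \<Longrightarrow> v (j + k) = v (p + 2 * i + k)"
      using recurrent_later_occurrence[OF rec, of "p + 2 * m" "2 * n + 5" "p + 2 * i"] by blast
    have "v (j + s) = v (j + s + 1)"
      using j(2)[of s] j(2)[of "s + 1"] s by (simp add: add.assoc)
    then have "even ((j + s) + (p + 2 * i + s))" using s(2) by (rule even_sum)
    then have "even (j - p)" using j(1) by simp
    then obtain l where l: "j - p = 2 * l" by (blast elim: evenE)
    then have jl: "j = p + 2 * l" using j(1) by simp
    have "w (l + k) = w (i + k)" if "k < n" for k
      using j(2)[of "2 * k"] that by (simp add: w_def jl algebra_simps)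
    moreover have "m \<le> l" using j(1) jl by simp
    ultimately show "\<exists>j\<ge>m. \<forall>k<n. w (j + k) = w (i + k)" by blast
  qed
  moreover have cube_w: "\<not> is_factor w [a, a, a]" for a
  proof
    assume "is_factor w [a, a, a]"
    then obtain i where e: "w i = a" "w (i + 1) = a" "w (i + 2) = a"
      unfolding is_factor_triple_iff by blast
    obtain s where s: "s < 4" "v (p + 2 * i + s) = v (p + 2 * i + s + 1)" using window by blast
    have "v (p + 2 * i + k) = a + of_nat (k mod 2)" if "k < 5" for k
    proof -
      have "(2 * i + k) div 2 = i + k div 2" "k div 2 = 0 \<or> k div 2 = 1 \<or> k div 2 = 2" using that by auto
      then show ?thesis using v[of "2 * i + k"] e by (auto simp: add.assoc)
    qed
    from this[of s] this[of "s + 1"] s have "a + of_nat (s mod 2) = a + of_nat ((s + 1) mod 2)"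
      by (simp add: add.assoc)
    then show False by (cases a; cases "even s") (auto simp: even_iff_mod_2_eq_zero odd_iff_mod_2_eq_one mod_Suc)
  qed
  moreover have "subword_complexity w n = subword_complexity TM0 n" if "n \<ge> 3" for n
  proof -
    \<comment> \<open>At an odd length, both summands in the recurrence are the complexity at length \<open>n\<close>.\<close>
    have n: "(2 * n - 1 + 1) div 2 = n" "(2 * n - 1) div 2 + 1 = n" "2 * n - 1 \<ge> 4" "2 * n - 1 \<ge> 3"
      using that by simp_all
    have "2 * subword_complexity w n = subword_complexity v (2 * n - 1)"
      using complexity_morphism_image[OF vw _ cube_w n(3)] rec unfolding n by simp
    also have "\<dots> = subword_complexity TM0 (2 * n - 1)" using c n(4) by blast
    also have "\<dots> = 2 * subword_complexity TM0 n"
      using complexity_morphism_image[OF suffix_0_TM0 _ TM0_no_cube n(3)] unfolding n by simp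
    finally show ?thesis by simp
  qed
  ultimately have "thue_morse_like w" by (simp add: thue_morse_like_def)
  then show thesis using vw that by blast
qed

text \<open>
Desubstitution shortens factors to about half their length until at most two letters are left, and
all words of length 2 are factors of the Thue-Morse word. Applying the morphism again turns
factors of the Thue-Morse word into factors of the Thue-Morse word.
\<close>

lemma thue_morse_like_window_factor_TM0:
  fixes v :: "bit word"
  assumes "thue_morse_like v"
  shows "is_factor TM0 (v [i \<rightarrow> i + n])"
  using assms
proof (induction n arbitrary: v i rule: less_induct)
  case (less n)
  show ?case
  proof (cases "n \<le> 2")
    case True
    have "[v i, v (i + 1)] = (v [i \<rightarrow> i + n]) @ drop n [v i, v (i + 1)]"
      using True by (cases n; cases "n - 1") (auto simp: subsequence_def)
    then show ?thesis using pair_is_factor_TM0 is_factor_appendD1 by metis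
  next
    case False
    obtain p w where w: "thue_morse_like w" and vw: "suffix p v = morphism_image thue_morse_morphism w"
      using desubstitution[OF less.prems] .
    have v: "v (p + k) = w (k div 2) + of_nat (k mod 2)" for k
      using vw by (simp add: suffix_eq_morphism_image_iff)
    obtain j where j: "p \<le> j" "\<And>k. k < n \<Longrightarrow> v (j + k) = v (i + k)"
      using recurrent_later_occurrence less.prems unfolding thue_morse_like_def by metis
    define r where "r = j - p"
    define s where "s = r mod 2"
    define q where "q = r div 2"
    have r: "r = 2 * q + s" "s < 2" by (simp_all add: s_def q_def)
    have "is_factor TM0 (w [q \<rightarrow> q + (n div 2 + 1)])"
      using False by (intro less.IH w) auto
    then obtain l where "w [q \<rightarrow> q + (n div 2 + 1)] = TM0 [l \<rightarrow> l + (n div 2 + 1)]"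
      by (auto elim!: is_factorE)
    then have l: "w (q + k) = TM0 (l + k)" if "k < n div 2 + 1" for k
      using that by (simp only: subsequence_eq_iff)
    have "v (i + k) = TM0 (2 * l + s + k)" if "k < n" for k
    proof -
      have half: "(2 * m + s + k) div 2 = m + (s + k) div 2" "(2 * m + s + k) mod 2 = (s + k) mod 2" for m
        by presburger+
      have "(s + k) div 2 < n div 2 + 1" using that r(2) by linarith
      then have "w (q + (s + k) div 2) = TM0 (l + (s + k) div 2)" by (rule l)
      moreover have "j + k = p + (2 * q + s + k)" using j(1) r(1) r_def by linarith
      then have "v (i + k) = v (p + (2 * q + s + k))" using j(2)[OF that] by (simp only:)
      ultimately show ?thesis
        unfolding v TM0_rec[of "2 * l + s + k"] half by simp
    qed
    then have "v [i \<rightarrow> i + n] = TM0 [2 * l + s \<rightarrow> 2 * l + s + n]"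
      unfolding subsequence_eq_iff by blast
    then show ?thesis by (simp only: is_factorI)
  qed
qed

section \<open>Abelian complexity and cubes of letters\<close>

lemma card_quotient_kernel:
  "card (A // {(x, y) \<in> A \<times> A. f x = f y}) = card (f ` A)"
proof -
  let ?r = "{(x, y) \<in> A \<times> A. f x = f y}"
  have "A // ?r = (\<lambda>x. ?r `` {x}) ` A" by (auto simp: quotient_def)
  also have "\<dots> = (\<lambda>x. {y \<in> A. f y = f x}) ` A" by (rule image_cong) auto
  also have "\<dots> = (\<lambda>z. {y \<in> A. f y = z}) ` f ` A" by (simp add: image_image)
  finally have "A // ?r = (\<lambda>z. {y \<in> A. f y = z}) ` f ` A" .
  moreover have "inj_on (\<lambda>z. {y \<in> A. f y = z}) (f ` A)"
    by (rule inj_onI) blast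
  ultimately show ?thesis by (simp add: card_image)
qed

lemma count_list_bit: "count_list u (0 :: bit) + count_list u 1 = length u"
proof (induction u)
  case (Cons a u)
  then show ?case by (cases a) auto
qed simp

lemma abelian_complexity_bit:
  fixes v :: "bit word"
  shows "abelian_complexity v n = card ((\<lambda>u. count_list u 1) ` factors v n)"
proof -
  have "abelian_equivalent u u' \<longleftrightarrow> count_list u 1 = count_list u' 1"
    if "u \<in> factors v n" "u' \<in> factors v n" for u u'
    using that count_list_bit[of u] count_list_bit[of u']
    unfolding abelian_equivalent_def bit_all by (auto simp: factors_eq)
  then have "{(u, u') \<in> factors v n \<times> factors v n. abelian_equivalent u u'}
    = {(u, u') \<in> factors v n \<times> factors v n. count_list u 1 = count_list u' 1}"
    by auto
  then show ?thesis unfolding abelian_complexity_def by (simp only: card_quotient_kernel)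
qed

lemma abelian_complexity_TM0_3: "abelian_complexity TM0 3 = 2"
proof -
  have "(\<lambda>u. count_list u 1) ` cube_free_triples = {1, 2}"
    by (auto simp: cube_free_triples_def)
  then show ?thesis by (simp add: abelian_complexity_bit factors_TM0_3)
qed

text \<open>
This is where Abelian complexity enters. The eight words of length 3 form four classes, of sizes
1, 3, 3, 1. Six words in just two classes must fill the two classes of size 3.
\<close>

lemma no_cube_if_abelian_complexity_3:
  fixes v :: "bit word"
  assumes "subword_complexity v 3 = 6" "abelian_complexity v 3 = 2"
  shows "\<not> is_factor v [a, a, a]"
proof
  assume a: "is_factor v [a, a, a]"
  define F where "F = factors v 3"
  define f where "f = (\<lambda>u::bit list. count_list u 1)"
  have F: "card F = 6" "card (f ` F) = 2"
    using assms by (simp_all add: F_def f_def subword_complexity_def abelian_complexity_bit)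
  have sub: "F \<subseteq> cube_free_triples \<union> {[0, 0, 0], [1, 1, 1]}"
  proof
    fix u assume "u \<in> F"
    then obtain p q r where "u = [p, q, r]" by (auto simp: F_def factors_eq length_eq_3_iff)
    then show "u \<in> cube_free_triples \<union> {[0, 0, 0], [1, 1, 1]}"
      by (cases p; cases q; cases r) (auto simp: cube_free_triples_def)
  qed
  have "k \<in> f ` F" if k: "k = 1 \<or> k = 2" for k
  proof (rule ccontr)
    assume *: "k \<notin> f ` F"
    define G where "G = (if k = 1 then {[0, 1, 1], [1, 0, 1], [1, 1, 0], [0, 0, 0], [1, 1, 1]}
      else {[0, 0, 1], [0, 1, 0], [1, 0, 0], [0, 0, 0], [1, 1, 1 :: bit]})"
    have "F \<subseteq> G"
    proof
      fix u assume "u \<in> F"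
      then have "u \<in> cube_free_triples \<union> {[0, 0, 0], [1, 1, 1]}" "f u \<noteq> k" using sub * by auto
      then show "u \<in> G" using k by (auto simp: G_def cube_free_triples_def f_def)
    qed
    moreover have "finite G" "card G = 5" by (auto simp: G_def)
    ultimately show False using F(1) card_mono[of G F] by simp
  qed
  then have "{1, 2} \<subseteq> f ` F" by auto
  moreover have "f [a, a, a] \<in> f ` F" using a by (auto simp: F_def factors_eq)
  moreover have "f [a, a, a] \<in> {0, 3}" by (cases a) (simp_all add: f_def)
  ultimately have "{f [a, a, a], 1, 2} \<subseteq> f ` F" "card {f [a, a, a], 1, 2} = 3" by auto
  moreover have "finite (f ` F)" using F(2) by (intro card_ge_0_finite) simp
  ultimately show False using F(2) card_mono[of "f ` F" "{f [a, a, a], 1, 2}"] by simp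
qed

section \<open>The subshift\<close>

lemma funpow_shift: "(shift ^^ m) x = suffix m x"
  by (induction m) (auto simp: shift_def suffix_def fun_eq_iff)

lemma in_subshift_iff:
  fixes x y :: "'a word"
  shows "x \<in> subshift_generated_by y \<longleftrightarrow> (\<forall>n. is_factor y (x [0 \<rightarrow> n]))"
proof -
  let ?T = "product_topology (\<lambda>_::nat. discrete_topology (UNIV :: 'a set)) UNIV"
  have orbit: "{(shift ^^ m) y | m. True} = range (\<lambda>m. suffix m y)" by (auto simp: funpow_shift)
  have fac: "is_factor y (x [0 \<rightarrow> n]) \<longleftrightarrow> (\<exists>m. \<forall>k<n. x k = y (m + k))" for n
  proof -
    have "is_factor y (x [0 \<rightarrow> n]) \<longleftrightarrow> (\<exists>m. x [0 \<rightarrow> 0 + n] = y [m \<rightarrow> m + n])"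
      by (simp add: is_factor_def factors_def)
    then show ?thesis unfolding subsequence_eq_iff by simp
  qed
  show ?thesis
    unfolding subshift_generated_by_def orbit fac
  proof
    assume x: "x \<in> ?T closure_of range (\<lambda>m. suffix m y)"
    show "\<forall>n. \<exists>m. \<forall>k<n. x k = y (m + k)"
    proof
      fix n
      define U where "U = PiE UNIV (\<lambda>k. if k < n then {x k} else UNIV)"
      have "openin ?T U" unfolding U_def 
        by (rule product_topology_basis) (auto intro: finite_subset[of _ "{..<n}"])
      moreover have "x \<in> U" by (auto simp: U_def)
      ultimately obtain m where "suffix m y \<in> U" using x by (auto simp: in_closure_of)
      then have "\<forall>k<n. x k = y (m + k)" by (auto simp: U_def PiE_iff suffix_def split: if_splits)
      then show "\<exists>m. \<forall>k<n. x k = y (m + k)" by blast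
    qed
  next
    assume *: "\<forall>n. \<exists>m. \<forall>k<n. x k = y (m + k)"
    show "x \<in> ?T closure_of range (\<lambda>m. suffix m y)"
      unfolding in_closure_of
    proof (intro conjI allI impI)
      show "x \<in> topspace ?T" by simp
      fix V assume "x \<in> V \<and> openin ?T V"
      then obtain U where U: "finite {k. U k \<noteq> UNIV}" "x \<in> PiE UNIV U" "PiE UNIV U \<subseteq> V"
        by (auto simp: openin_product_topology_alt)
      obtain n where n: "\<And>k. U k \<noteq> UNIV \<Longrightarrow> k < n"
        using U(1) by (auto simp: finite_nat_set_iff_bounded)
      obtain m where m: "\<And>k. k < n \<Longrightarrow> x k = y (m + k)" using * by blast
      have "suffix m y k \<in> U k" for k
      proof (cases "U k = UNIV")
        case False
        then have "suffix m y k = x k" using m n by (simp add: suffix_def)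
        then show ?thesis using U(2) by (auto simp: PiE_iff)
      qed simp
      then have "suffix m y \<in> V" using U(3) by (auto simp: PiE_iff)
      then show "\<exists>z. z \<in> range (\<lambda>m. suffix m y) \<and> z \<in> V" by blast
    qed
  qed
qed

section \<open>Uniform recurrence of the Thue-Morse word\<close>

text \<open>
The Thue-Morse word is a concatenation of blocks of length \<open>2 ^ k\<close>; the block number \<open>m\<close> is the
prefix of that length, with letters exchanged if the letter \<open>m\<close> is 1.
\<close>

lemma TM0_power: "r < 2 ^ k \<Longrightarrow> TM0 (2 ^ k * m + r) = TM0 m + TM0 r"
proof (induction k arbitrary: m r)
  case 0
  then show ?case using TM0_fixed_point(1) by (cases "TM0 m") auto
next
  case (Suc k)
  have "r div 2 < 2 ^ k" using Suc.prems by auto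
  have "2 ^ Suc k * m + r = 2 * (2 ^ k * m) + r" by simp
  then have "(2 ^ Suc k * m + r) div 2 = 2 ^ k * m + r div 2" "(2 ^ Suc k * m + r) mod 2 = r mod 2"
    by presburger+
  then have "TM0 (2 ^ Suc k * m + r) = TM0 (2 ^ k * m + r div 2) + of_nat (r mod 2)"
    using TM0_rec[of "2 ^ Suc k * m + r"] by simp
  also have "\<dots> = TM0 m + TM0 r"
    using Suc.IH[OF \<open>r div 2 < 2 ^ k\<close>, of m] TM0_rec[of r] by (simp only: add.assoc)
  finally show ?case .
qed

text \<open>
A given factor occurs in a prefix of length \<open>2 ^ e\<close>, and this prefix is repeated in one of any
three consecutive blocks of that length, because three consecutive letters of the Thue-Morse word
are never all equal to 1.
\<close>

lemma TM0_uniformly_recurrent: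
  "\<exists>N. \<forall>i. \<exists>j\<ge>i. j + n \<le> i + N \<and> (\<forall>k<n. TM0 (j + k) = TM0 (l + k))"
proof -
  obtain e where e: "l + n < 2 ^ e" using less_exp by blast
  show ?thesis
  proof (rule exI[of _ "4 * 2 ^ e"], rule allI)
    fix i :: nat
    define m where "m = i div 2 ^ e + 1"
    obtain c where c: "c < 3" "TM0 (m + c) = 0"
    proof -
      have "\<not> (TM0 m = 1 \<and> TM0 (m + 1) = 1 \<and> TM0 (m + 2) = 1)"
        using TM0_no_cube[of 1] unfolding is_factor_triple_iff by blast
      then show thesis using that[of 0] that[of 1] that[of 2] by auto
    qed
    define j where "j = 2 ^ e * (m + c) + l"
    have "i = 2 ^ e * (i div 2 ^ e) + i mod 2 ^ e" "i mod 2 ^ e < 2 ^ e" by simp_all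
    then have i: "i \<le> 2 ^ e * m" "2 ^ e * m \<le> i + 2 ^ e" unfolding m_def by (simp_all only: distrib_left)
    have "j \<ge> i" using i(1) unfolding j_def by (simp add: distrib_left)
    moreover have "j + n \<le> i + 4 * 2 ^ e"
    proof -
      have "2 ^ e * (m + c) = 2 ^ e * m + 2 ^ e * c" by (rule distrib_left)
      moreover have "(2::nat) ^ e * c \<le> 2 ^ e * 2" using c(1) by (intro mult_le_mono) auto
      ultimately show ?thesis using i(2) e unfolding j_def by linarith
    qed
    moreover have "TM0 (j + k) = TM0 (l + k)" if "k < n" for k
      using TM0_power[of "l + k" e "m + c"] that e c(2) by (simp add: j_def add.assoc)
    ultimately show "\<exists>j\<ge>i. j + n \<le> i + 4 * 2 ^ e \<and> (\<forall>k<n. TM0 (j + k) = TM0 (l + k))" by blast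
  qed
qed

text \<open>
Elements of the subshift have no other factors than the Thue-Morse word by approximation, and have
all of them by uniform recurrence.
\<close>

lemma factors_eq_if_in_subshift:
  fixes x :: "bit word"
  assumes "x \<in> subshift_generated_by TM0"
  shows "factors x n = factors TM0 n"
proof
  have fac: "\<exists>m. \<forall>k<N. x k = TM0 (m + k)" for N
  proof -
    have "is_factor TM0 (x [0 \<rightarrow> 0 + N])" using assms by (simp add: in_subshift_iff)
    then obtain m where "x [0 \<rightarrow> 0 + N] = TM0 [m \<rightarrow> m + N]"
      by (auto simp: is_factor_def factors_def)
    then show ?thesis unfolding subsequence_eq_iff by auto
  qed
  show "factors x n \<subseteq> factors TM0 n"
  proof
    fix u assume "u \<in> factors x n"
    then obtain i where u: "u = x [i \<rightarrow> i + n]" by (auto simp: factors_def)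
    obtain m where "\<forall>k<i + n. x k = TM0 (m + k)" using fac by blast
    then have "u = TM0 [m + i \<rightarrow> m + i + n]" unfolding u subsequence_eq_iff by (simp add: add.assoc)
    then show "u \<in> factors TM0 n" by (auto simp: factors_def)
  qed
  show "factors TM0 n \<subseteq> factors x n"
  proof
    fix u assume "u \<in> factors TM0 n"
    then obtain l where u: "u = TM0 [l \<rightarrow> l + n]" by (auto simp: factors_def)
    obtain N where N: "\<And>i. \<exists>j\<ge>i. j + n \<le> i + N \<and> (\<forall>k<n. TM0 (j + k) = TM0 (l + k))"
      using TM0_uniformly_recurrent by blast
    obtain m where m: "\<forall>k<N. x k = TM0 (m + k)" using fac by blast
    obtain j where j: "j \<ge> m" "j + n \<le> m + N" "\<forall>k<n. TM0 (j + k) = TM0 (l + k)" using N by blast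
    have "x (j - m + k) = TM0 (l + k)" if "k < n" for k
      using m[rule_format, of "j - m + k"] j that by simp
    then have "u = x [j - m \<rightarrow> j - m + n]" unfolding u subsequence_eq_iff by simp
    then show "u \<in> factors x n" by (auto simp: factors_def)
  qed
qed

section \<open>The characterization\<close>

theorem theorem4:
  fixes \<omega> :: "bit word"
  assumes "recurrent \<omega>"
  shows "(\<forall>n. subword_complexity \<omega> n = subword_complexity TM0 n) \<and>
         (\<forall>n. abelian_complexity \<omega> n = abelian_complexity TM0 n)
         \<longleftrightarrow> \<omega> \<in> subshift_generated_by TM0"
proof
  assume *: "(\<forall>n. subword_complexity \<omega> n = subword_complexity TM0 n) \<and>
         (\<forall>n. abelian_complexity \<omega> n = abelian_complexity TM0 n)"
  then have "\<not> is_factor \<omega> [a, a, a]" for a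
    by (intro no_cube_if_abelian_complexity_3) (simp_all add: complexity_TM0 abelian_complexity_TM0_3)
  then have "thue_morse_like \<omega>" using assms * by (simp add: thue_morse_like_def)
  then have "is_factor TM0 (\<omega> [0 \<rightarrow> n])" for n
    using thue_morse_like_window_factor_TM0[of \<omega> 0 n] by simp
  then show "\<omega> \<in> subshift_generated_by TM0" by (simp add: in_subshift_iff)
next
  assume "\<omega> \<in> subshift_generated_by TM0"
  then have "factors \<omega> n = factors TM0 n" for n by (rule factors_eq_if_in_subshift)
  then show "(\<forall>n. subword_complexity \<omega> n = subword_complexity TM0 n) \<and>
         (\<forall>n. abelian_complexity \<omega> n = abelian_complexity TM0 n)"
    by (simp add: subword_complexity_def abelian_complexity_def)
qed

end
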